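(* Let $A$ be a $d$-dimensional configuration of $n$ points and degree $\delta=\deg(A)$ such that $d\ge \delta+\frac{n-1}{2}$. Then $A$ is a pyramid.
   Context: A $d$-dimensional point configuration is a finite family $A$ of points whose affine span is $\mathbb{R}^d$; repeated points are allowed and counted with multiplicity (as distinct labelled elements). A non-empty subset $S\subseteq A$ is an interior face of $A$ if $\mathrm{conv}(S)$ is not contained in the boundary of $\mathrm{conv}(A)$. The degree $\deg(A)$ is the maximal codimension $d-\dim\mathrm{conv}(S)$ of an interior face $S$ of $A$. The configuration $A$ is a pyramid if there is an element $p\in A$ that does not lie in the affine hull of the remaining elements $A\setminus\{p\}$ (with $\mathrm{aff}(\emptyset)=\emptyset$). *)

theory Defs
  imports "HOL-Analysis.Analysis"
begin

text \<open>A configuration is a labelled family \<open>p\<close> of points over a finite index set \<open>I\<close>, so that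
  repeated points are distinct elements.

  Types of class \<open>euclidean_space\<close> have dimension at least 1. In order not to lose the case
  \<open>d = 0\<close>, the affine span is only required to have dimension \<open>d\<close>, and thus to be a copy of
  the space of dimension \<open>d\<close> inside the ambient one; the boundary of the convex hull is accordingly
  taken relative to that span. If the span is the whole type, this is the literal notion, see
  \<open>point_configuration_full\<close> and \<open>interior_face_full\<close> below.\<close>

definition point_configuration :: "nat \<Rightarrow> 'i set \<Rightarrow> ('i \<Rightarrow> 'a::euclidean_space) \<Rightarrow> bool" where
  "point_configuration d I p \<longleftrightarrow> finite I \<and> aff_dim (affine hull (p ` I)) = int d"

definition interior_face :: "'i set \<Rightarrow> ('i \<Rightarrow> 'a::euclidean_space) \<Rightarrow> 'i set \<Rightarrow> bool" where
  "interior_face I p S \<longleftrightarrow> S \<noteq> {} \<and> S \<subseteq> I \<and>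
     \<not> convex hull (p ` S) \<subseteq> rel_frontier (convex hull (p ` I))"

definition config_degree :: "'i set \<Rightarrow> ('i \<Rightarrow> 'a::euclidean_space) \<Rightarrow> int" where
  "config_degree I p =
     Max {aff_dim (affine hull (p ` I)) - aff_dim (convex hull (p ` S)) | S. interior_face I p S}"

definition is_pyramid :: "'i set \<Rightarrow> ('i \<Rightarrow> 'a::euclidean_space) \<Rightarrow> bool" where
  "is_pyramid I p \<longleftrightarrow> (\<exists>i\<in>I. p i \<notin> affine hull (p ` (I - {i})))"

lemma point_configuration_full:
  fixes p :: "'i \<Rightarrow> 'a::euclidean_space"
  shows "point_configuration DIM('a) I p \<longleftrightarrow> finite I \<and> affine hull (p ` I) = UNIV"
  unfolding point_configuration_def using aff_dim_eq_full[of "p ` I"] by simp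

lemma interior_face_full:
  fixes p :: "'i \<Rightarrow> 'a::euclidean_space"
  assumes "affine hull (p ` I) = UNIV"
  shows "interior_face I p S \<longleftrightarrow> S \<noteq> {} \<and> S \<subseteq> I \<and>
    \<not> convex hull (p ` S) \<subseteq> frontier (convex hull (p ` I))"
  using assms by (simp add: interior_face_def rel_frontier_frontier)

text \<open>The maximum defining the degree ranges over a finite non-empty set of non-negative numbers.\<close>

lemma config_degree_set:
  fixes p :: "'i \<Rightarrow> 'a::euclidean_space"
  assumes "point_configuration d I p"
  defines "C \<equiv> {aff_dim (affine hull (p ` I)) - aff_dim (convex hull (p ` S)) | S. interior_face I p S}"
  shows "finite C" "C \<noteq> {}" "\<And>c. c \<in> C \<Longrightarrow> 0 \<le> c"
proof -
  have fin: "finite I" and ne: "I \<noteq> {}"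
    using assms(1) by (auto simp: point_configuration_def)
  have "{S. interior_face I p S} \<subseteq> Pow I"
    by (auto simp: interior_face_def)
  then have "finite {S. interior_face I p S}"
    using fin finite_subset by blast
  then show "finite C"
    unfolding C_def by simp
  have "rel_interior (convex hull (p ` I)) \<noteq> {}"
    using ne by (simp add: rel_interior_eq_empty)
  then obtain x where "x \<in> rel_interior (convex hull (p ` I))"
    by blast
  then have "x \<in> convex hull (p ` I)" "x \<notin> rel_frontier (convex hull (p ` I))"
    using rel_interior_subset by (auto simp: rel_frontier_def)
  then have "interior_face I p I"
    using ne by (auto simp: interior_face_def)
  then show "C \<noteq> {}"
    unfolding C_def by blast
  fix c assume "c \<in> C"
  then obtain S where S: "c = aff_dim (affine hull (p ` I)) - aff_dim (convex hull (p ` S))"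
      "S \<subseteq> I"
    unfolding C_def interior_face_def by blast
  then have "aff_dim (p ` S) \<le> aff_dim (p ` I)"
    by (intro aff_dim_subset image_mono)
  with S(1) show "0 \<le> c"
    by (simp add: aff_dim_convex_hull)
qed

end

theory Submission
  imports Defs
begin

text \<open>If the configuration is not a pyramid, every label carries a non-zero coefficient in some
  affine dependence, so a generic dependence has no zero coefficient at all. Normalising its positive
  and its negative part expresses one point \<open>x\<close> as a convex combination of two complementary
  sets of labels. Averaging the two expressions gives \<open>x\<close> positive weight on every label, so
  \<open>x\<close> is relatively interior and both sets are interior faces. The smaller one has at most
  \<open>n/2\<close> elements, hence dimension at most \<open>n/2 - 1\<close>.\<close>

text \<open>Coefficients are attached to labels rather than to points, so two labels of the same
  point already carry a non-trivial dependence.\<close>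

definition affine_dependence :: "'i set \<Rightarrow> ('i \<Rightarrow> 'a::real_vector) \<Rightarrow> ('i \<Rightarrow> real) \<Rightarrow> bool" where
  "affine_dependence I p c \<longleftrightarrow> sum c I = 0 \<and> (\<Sum>i\<in>I. c i *\<^sub>R p i) = 0"

lemma affine_dependence_add_scaled:
  assumes "affine_dependence I p c" "affine_dependence I p e"
  shows "affine_dependence I p (\<lambda>i. c i + t * e i)"
  using assms unfolding affine_dependence_def
  by (simp add: sum.distrib scaleR_add_left flip: sum_distrib_left scaleR_scaleR scaleR_sum_right)

lemma affine_dependence_uminus:
  "affine_dependence I p c \<Longrightarrow> affine_dependence I p (\<lambda>i. - c i)"
  by (simp add: affine_dependence_def sum_negf)

lemma affine_hull_image_coefficients:
  fixes p :: "'i \<Rightarrow> 'a::real_vector"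
  assumes "finite J" "x \<in> affine hull (p ` J)"
  obtains c where "sum c J = 1" "(\<Sum>j\<in>J. c j *\<^sub>R p j) = x"
proof -
  let ?S = "{\<Sum>j\<in>J. c j *\<^sub>R p j | c. sum c J = 1}"
  have "affine ?S"
    unfolding affine_def
  proof clarify
    fix u v :: real and c e :: "'i \<Rightarrow> real"
    assume uv: "u + v = 1" and ce: "sum c J = 1" "sum e J = 1"
    have "u *\<^sub>R (\<Sum>j\<in>J. c j *\<^sub>R p j) + v *\<^sub>R (\<Sum>j\<in>J. e j *\<^sub>R p j) =
        (\<Sum>j\<in>J. (u * c j + v * e j) *\<^sub>R p j)"
      by (simp add: scaleR_sum_right sum.distrib scaleR_add_left)
    moreover have "(\<Sum>j\<in>J. u * c j + v * e j) = 1"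
      using uv ce by (simp add: sum.distrib flip: sum_distrib_left)
    ultimately show "\<exists>c'. u *\<^sub>R (\<Sum>j\<in>J. c j *\<^sub>R p j) + v *\<^sub>R (\<Sum>j\<in>J. e j *\<^sub>R p j) =
        (\<Sum>j\<in>J. c' j *\<^sub>R p j) \<and> sum c' J = 1"
      by (intro exI[of _ "\<lambda>j. u * c j + v * e j"]) simp
  qed
  moreover have "p ` J \<subseteq> ?S"
  proof clarify
    fix i assume "i \<in> J"
    then show "\<exists>c. p i = (\<Sum>j\<in>J. c j *\<^sub>R p j) \<and> sum c J = 1"
      using \<open>finite J\<close> by (intro exI[of _ "\<lambda>j. if j = i then 1 else 0"])
        (simp add: if_distrib[of "\<lambda>t. t *\<^sub>R _"] cong: if_cong)
  qed
  ultimately have "affine hull (p ` J) \<subseteq> ?S"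
    by (rule hull_minimal[rotated])
  then show thesis
    using assms(2) that by blast
qed

lemma affine_dependence_nonzero_at:
  assumes "finite I" "i \<in> I" "p i \<in> affine hull (p ` (I - {i}))"
  obtains e where "affine_dependence I p e" "e i \<noteq> 0"
proof -
  obtain c where c: "sum c (I - {i}) = 1" "(\<Sum>j\<in>I - {i}. c j *\<^sub>R p j) = p i"
    using affine_hull_image_coefficients[of "I - {i}" "p i" p] assms by auto
  \<comment> \<open>Moving \<open>p i\<close> to the other side of its affine expression turns it
    into a dependence with coefficient -1 at \<open>i\<close>.\<close>
  define e where "e = c(i := - 1)"
  have "sum e (I - {i}) = sum c (I - {i})"
    "(\<Sum>j\<in>I - {i}. e j *\<^sub>R p j) = (\<Sum>j\<in>I - {i}. c j *\<^sub>R p j)"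
    by (auto simp: e_def intro: sum.cong)
  then have "affine_dependence I p e" "e i \<noteq> 0"
    using c assms(1,2) by (auto simp: affine_dependence_def sum.remove[of I i] e_def)
  then show thesis by (rule that)
qed

lemma affine_dependence_nowhere_zero:
  assumes "finite I" "\<not> is_pyramid I p"
  obtains c where "affine_dependence I p c" "\<And>i. i \<in> I \<Longrightarrow> c i \<noteq> 0"
proof -
  \<comment> \<open>The dependence always lives on all of \<open>I\<close>; only the set
    \<open>J\<close> of labels where it must not vanish grows.\<close>
  have "\<exists>c. affine_dependence I p c \<and> (\<forall>i\<in>J. c i \<noteq> 0)" if "finite J" "J \<subseteq> I" for J
    using that
  proof (induction J)
    case empty
    have "affine_dependence I p (\<lambda>_. 0)"
      by (simp add: affine_dependence_def)
    then show ?case by blast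
  next
    case (insert i J)
    then obtain c where c: "affine_dependence I p c" "\<forall>j\<in>J. c j \<noteq> 0"
      by auto
    have "p i \<in> affine hull (p ` (I - {i}))"
      using assms(2) insert.prems by (auto simp: is_pyramid_def)
    then obtain e where e: "affine_dependence I p e" "e i \<noteq> 0"
      using affine_dependence_nonzero_at[of I i p] assms(1) insert.prems by auto
    \<comment> \<open>Each label rules out at most one \<open>t\<close>. Where
      \<open>e j = 0\<close> the quotient is 0 by convention, which merely excludes
      \<open>t = 0\<close>; there \<open>j\<close> differs from \<open>i\<close>, so
      \<open>c j\<close> itself is non-zero.\<close>
    obtain t where t: "t \<notin> (\<lambda>j. - c j / e j) ` insert i J"
      using ex_new_if_finite[OF infinite_UNIV_char_0] insert.hyps(1)
      by (metis finite.insertI finite_imageI)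
    have "c j + t * e j \<noteq> 0" if "j \<in> insert i J" for j
    proof (cases "e j = 0")
      case True
      then show ?thesis using c(2) e(2) that by auto
    next
      case False
      moreover have "t \<noteq> - c j / e j" using t that by blast
      ultimately show ?thesis by (auto simp: field_simps add_eq_0_iff)
    qed
    then show ?case
      using affine_dependence_add_scaled[OF c(1) e(1)] by blast
  qed
  from this[OF assms(1) order_refl] show thesis
    using that by blast
qed

text \<open>A hyperplane supporting the hull at this point would contain every \<open>p i\<close>,
  since all weights are positive. It would then contain the whole hull, although it must miss the
  relative interior.\<close>

lemma positive_convex_combination_notin_rel_frontier:
  fixes p :: "'i \<Rightarrow> 'a::euclidean_space"
  assumes fin: "finite I" and pos: "\<And>i. i \<in> I \<Longrightarrow> w i > 0" and sum1: "sum w I = 1"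
  shows "(\<Sum>i\<in>I. w i *\<^sub>R p i) \<notin> rel_frontier (convex hull (p ` I))"
proof
  let ?C = "convex hull (p ` I)"
  define x where "x = (\<Sum>i\<in>I. w i *\<^sub>R p i)"
  assume "(\<Sum>i\<in>I. w i *\<^sub>R p i) \<in> rel_frontier ?C"
  then have "x \<in> closure ?C" "x \<notin> rel_interior ?C"
    by (auto simp: rel_frontier_def x_def)
  then obtain a where le: "\<And>y. y \<in> closure ?C \<Longrightarrow> a \<bullet> x \<le> a \<bullet> y"
      and less: "\<And>y. y \<in> rel_interior ?C \<Longrightarrow> a \<bullet> x < a \<bullet> y"
    using supporting_hyperplane_relative_frontier[OF convex_convex_hull] by metis
  have ge: "a \<bullet> x \<le> a \<bullet> p i" if "i \<in> I" for i
    using le[of "p i"] that hull_subset[of "p ` I" convex] closure_subset[of ?C] by blast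
  \<comment> \<open>Both terms on the right agree because the weights sum to 1; a vanishing sum of
    non-negative terms then makes each term zero.\<close>
  have "(\<Sum>i\<in>I. w i * (a \<bullet> p i - a \<bullet> x)) = a \<bullet> x - sum w I * (a \<bullet> x)"
    by (simp add: x_def inner_sum_right right_diff_distrib sum_subtractf sum_distrib_right)
  then have "(\<Sum>i\<in>I. w i * (a \<bullet> p i - a \<bullet> x)) = 0"
    by (simp add: sum1)
  then have "\<forall>i\<in>I. w i * (a \<bullet> p i - a \<bullet> x) = 0"
    using fin ge pos by (subst (asm) sum_nonneg_eq_0_iff) (auto simp: less_imp_le)
  then have "p ` I \<subseteq> {y. a \<bullet> y = a \<bullet> x}"
    using pos by fastforce
  then have "?C \<subseteq> {y. a \<bullet> y = a \<bullet> x}"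
    by (rule hull_minimal) (rule convex_hyperplane)
  moreover have "I \<noteq> {}"
    using sum1 by auto
  then obtain y where "y \<in> rel_interior ?C"
    by (metis convex_convex_hull convex_hull_eq_empty ex_in_conv image_is_empty rel_interior_eq_empty)
  ultimately show False
    using less[of y] rel_interior_subset[of ?C] by auto
qed

text \<open>Stated for the positive part only: the negative part of \<open>c\<close> is the positive
  part of \<open>- c\<close>, which is again a dependence.\<close>

lemma interior_face_positive_part:
  fixes p :: "'i \<Rightarrow> 'a::euclidean_space"
  assumes fin: "finite I" and ne: "I \<noteq> {}"
    and dep: "affine_dependence I p c" and nz: "\<And>i. i \<in> I \<Longrightarrow> c i \<noteq> 0"
  shows "interior_face I p {i \<in> I. c i > 0}"
proof -
  let ?P = "{i \<in> I. c i > 0}"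
  define s where "s = sum c ?P"
  have P: "finite ?P" "?P \<noteq> {}"
  proof -
    show "finite ?P" using fin by simp
    show "?P \<noteq> {}"
    proof
      assume "?P = {}"
      then have "\<forall>i\<in>I. - c i > 0" using nz by force
      then have "(\<Sum>i\<in>I. - c i) > 0" using fin ne by (intro sum_pos) auto
      then show False using dep by (simp add: affine_dependence_def sum_negf)
    qed
  qed
  \<comment> \<open>As \<open>c\<close> sums to 0, its negative part has total \<open>- s\<close>,
    so the absolute values add up to \<open>2 * s\<close>.\<close>
  then have s: "s > 0"
    unfolding s_def by (intro sum_pos) auto
  define x where "x = (\<Sum>i\<in>?P. (c i / s) *\<^sub>R p i)"
  have "x \<in> convex hull (p ` ?P)"
    unfolding x_def
    using P s by (intro convex_sum convex_convex_hull)
      (auto simp: s_def hull_inc simp flip: sum_divide_distrib)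
  moreover
  \<comment> \<open>\<open>\<bar>c\<bar> = 2 c\<^sup>+ - c\<close>, so the weights \<open>\<bar>c\<bar> / (2 s)\<close> represent the same point as \<open>c\<^sup>+ / s\<close>.\<close>
  have absc: "\<bar>c i\<bar> = 2 * (if c i > 0 then c i else 0) - c i" for i
    by simp
  have "(\<Sum>i\<in>I. \<bar>c i\<bar> / (2 * s)) = 1"
  proof -
    have "(\<Sum>i\<in>I. \<bar>c i\<bar>) = 2 * s"
      using dep fin unfolding absc s_def affine_dependence_def
      by (simp add: sum_subtractf sum.inter_filter flip: sum_distrib_left)
    then show ?thesis
      using s by (simp flip: sum_divide_distrib)
  qed
  moreover have "(\<Sum>i\<in>I. (\<bar>c i\<bar> / (2 * s)) *\<^sub>R p i) = x"
  proof -
    have "(\<Sum>i\<in>I. (\<bar>c i\<bar> / (2 * s)) *\<^sub>R p i) = (1 / (2 * s)) *\<^sub>R (\<Sum>i\<in>I. \<bar>c i\<bar> *\<^sub>R p i)"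
      by (simp add: scaleR_sum_right)
    also have "(\<Sum>i\<in>I. \<bar>c i\<bar> *\<^sub>R p i) =
        2 *\<^sub>R (\<Sum>i\<in>I. (if c i > 0 then c i else 0) *\<^sub>R p i) - (\<Sum>i\<in>I. c i *\<^sub>R p i)"
      unfolding absc scaleR_diff_left sum_subtractf scaleR_sum_right by simp
    also have "(\<Sum>i\<in>I. (if c i > 0 then c i else 0) *\<^sub>R p i) = (\<Sum>i\<in>?P. c i *\<^sub>R p i)"
      using fin by (simp add: sum.inter_filter if_distrib[of "\<lambda>t. t *\<^sub>R _"] cong: if_cong)
    finally show ?thesis
      using dep by (simp add: affine_dependence_def x_def scaleR_sum_right)
  qed
  ultimately have "x \<notin> rel_frontier (convex hull (p ` I))"
    using positive_convex_combination_notin_rel_frontier[OF fin, of "\<lambda>i. \<bar>c i\<bar> / (2 * s)" p] nz s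
    by simp
  with \<open>x \<in> convex hull (p ` ?P)\<close> P(2) show ?thesis
    by (auto simp: interior_face_def)
qed

lemma small_interior_face_if_not_pyramid:
  fixes p :: "'i \<Rightarrow> 'a::euclidean_space"
  assumes fin: "finite I" and ne: "I \<noteq> {}" and np: "\<not> is_pyramid I p"
  obtains S where "interior_face I p S" "2 * card S \<le> card I"
proof -
  obtain c where c: "affine_dependence I p c" "\<And>i. i \<in> I \<Longrightarrow> c i \<noteq> 0"
    using affine_dependence_nowhere_zero[OF fin np] by blast
  let ?P = "{i \<in> I. c i > 0}" and ?N = "{i \<in> I. - c i > 0}"
  have "interior_face I p ?P" "interior_face I p ?N"
    using interior_face_positive_part[OF fin ne c]
      interior_face_positive_part[OF fin ne affine_dependence_uminus[OF c(1)]] c(2) by auto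
  moreover have "card ?P + card ?N = card I"
  proof -
    have "?P \<union> ?N = I" using c(2) by force
    then show ?thesis
      using card_Un_disjoint[of ?P ?N] fin by force
  qed
  ultimately show thesis
    using that by (cases "card ?P \<le> card ?N") force+
qed

theorem corollary3p9:
  fixes I :: "'i set" and p :: "'i \<Rightarrow> 'a::euclidean_space"
    and d n :: nat and \<delta> :: int
  assumes "point_configuration d I p"
    and "card I = n"
    and "config_degree I p = \<delta>"
    and "real d \<ge> real_of_int \<delta> + (real n - 1) / 2"
  shows "is_pyramid I p"
proof (rule ccontr)
  assume np: "\<not> is_pyramid I p"
  have fin: "finite I" and ne: "I \<noteq> {}" and d: "aff_dim (affine hull (p ` I)) = int d"
    using assms(1) by (auto simp: point_configuration_def)
  obtain S where S: "interior_face I p S" "2 * card S \<le> card I"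
    using small_interior_face_if_not_pyramid[OF fin ne np] .
  have "finite S"
    using S(1) fin finite_subset by (auto simp: interior_face_def)
  \<comment> \<open>Labels in \<open>S\<close> may share a point, hence the detour through the
    cardinality of the image.\<close>
  have "aff_dim (convex hull (p ` S)) \<le> int (card (p ` S)) - 1"
    using aff_dim_le_card[of "p ` S"] \<open>finite S\<close> by (simp add: aff_dim_convex_hull)
  also have "\<dots> \<le> int (card S) - 1"
    using card_image_le[OF \<open>finite S\<close>, of p] by simp
  finally have dimS: "aff_dim (convex hull (p ` S)) \<le> int (card S) - 1" .
  have "aff_dim (affine hull (p ` I)) - aff_dim (convex hull (p ` S)) \<le> \<delta>"
    unfolding assms(3)[symmetric] config_degree_def
    using S(1) config_degree_set(1)[OF assms(1)] by (intro Max_ge) auto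
  with dimS d have "int d - int (card S) + 1 \<le> \<delta>"
    by linarith
  then have "2 * int d + 2 \<le> 2 * \<delta> + int n"
    using S(2) assms(2) by linarith
  \<comment> \<open>The degree hypothesis, doubled, reads
    \<open>2 * d \<ge> 2 * \<delta> + n - 1\<close>, which contradicts this bound.\<close>
  then have "2 * real d + 2 \<le> 2 * real_of_int \<delta> + real n"
    by linarith
  with assms(4) show False
    by (simp add: field_simps)
qed

end
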